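(* For every integer $s>2$, \[ \mathrm{wsat}(2s+1, K_{s,s}) = \binom{2s+1}{2} - (4s-4). \]
   Context: For a fixed graph $F$, an $n$-vertex graph $G$ is called weakly $F$-saturated if $G$ contains no copy of $F$ and there exists an ordering $e_1,\dots,e_m$ of the edges of $E(K_n)\setminus E(G)$ such that for each $i\in\{1,\dots,m\}$ the graph $G\cup\{e_1,\dots,e_i\}$ contains a copy $F_i$ of $F$ with $e_i\in E(F_i)$. The weak saturation number $\mathrm{wsat}(n,F)$ is the minimum number of edges of a weakly $F$-saturated $n$-vertex graph. $K_{s,t}$ denotes the complete bipartite graph with parts of sizes $s$ and $t$. *)

theory Defs
  imports Complex_Main
begin

datatype 'a graph = Graph (verts: "'a set") (edges: "'a set set")

definition complete_graph :: "'a set \<Rightarrow> 'a graph" where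
  "complete_graph V = Graph V {{u, v} | u v. u \<in> V \<and> v \<in> V \<and> u \<noteq> v}"

definition simple_graph :: "'a graph \<Rightarrow> bool" where
  "simple_graph G \<longleftrightarrow> finite (verts G) \<and> edges G \<subseteq> edges (complete_graph (verts G))"

definition complete_bipartite :: "nat \<Rightarrow> nat \<Rightarrow> (nat + nat) graph" where
  "complete_bipartite s t =
     Graph ({..<s} <+> {..<t}) {{Inl i, Inr j} | i j. i < s \<and> j < t}"

definition subgraph :: "'a graph \<Rightarrow> 'a graph \<Rightarrow> bool" where
  "subgraph H G \<longleftrightarrow> simple_graph H \<and> verts H \<subseteq> verts G \<and> edges H \<subseteq> edges G"

definition graph_iso :: "'a graph \<Rightarrow> 'b graph \<Rightarrow> bool" where
  "graph_iso G H \<longleftrightarrow>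
     (\<exists>f. bij_betw f (verts G) (verts H) \<and> edges H = (\<lambda>e. f ` e) ` edges G)"

text \<open>Copies are not required to be induced subgraphs.\<close>

definition copy_in :: "'a graph \<Rightarrow> 'b graph \<Rightarrow> 'a graph \<Rightarrow> bool" where
  "copy_in H F G \<longleftrightarrow> subgraph H G \<and> graph_iso H F"

definition add_edges :: "'a graph \<Rightarrow> 'a set set \<Rightarrow> 'a graph" where
  "add_edges G S = Graph (verts G) (edges G \<union> S)"

text \<open>The edges are listed from index 0, so \<open>take (Suc i) es\<close> consists of
  the edges up to and including \<open>es ! i\<close>.\<close>

definition weakly_saturated :: "'b graph \<Rightarrow> 'a graph \<Rightarrow> bool" where
  "weakly_saturated F G \<longleftrightarrow>
     simple_graph G \<and>
     \<not> (\<exists>H. copy_in H F G) \<and>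
     (\<exists>es. distinct es \<and> set es = edges (complete_graph (verts G)) - edges G \<and>
        (\<forall>i < length es. \<exists>H. copy_in H F (add_edges G (set (take (Suc i) es))) \<and>
                              es ! i \<in> edges H))"

text \<open>All notions above are invariant under isomorphism, so the vertex set of an
  \<open>n\<close>-vertex graph is taken to be \<open>{..<n}\<close>. A minimum exists whenever \<open>F\<close> has an edge:
  an edge-maximal \<open>F\<close>-free graph is weakly \<open>F\<close>-saturated.\<close>

definition wsat :: "nat \<Rightarrow> 'b graph \<Rightarrow> nat" where
  "wsat n F = (LEAST m. \<exists>G :: nat graph.
     verts G = {..<n} \<and> weakly_saturated F G \<and> card (edges G) = m)"

end

(* Pass to the complement H of G in K_n, n = 2s+1. Adding an edge ab to G completes a K_{s,s}
   exactly when the n vertices split as A, B, {v} with |A| = |B| = s such that ab is the only edge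
   of H crossing between A and B. So G is weakly saturated iff H can be emptied by deleting sole
   crossing edges of balanced cuts and no balanced cut of H is uncrossed to begin with. Splitting
   along cuts shows that X spans at most 2|X| - 3 edges of such an H. Looking at the first two
   deletions more closely saves enough to give |H| <= 4s - 4; after the first deletion some cut is
   uncrossed, and then |H| <= 4s - 5. Hence an H with exactly 4s - 4 edges that can be emptied has
   no uncrossed cut, and it only remains to build one. *)

theory Submission
  imports Defs "HOL-Library.Disjoint_Sets"
begin

text \<open>The constants come from bookkeeping against the bound 2|X| - 3. On V it allows 4s - 1
  edges, and the two pieces of an uncrossed cut, which share the left-out vertex, allow 2(2(s + 1) -
  3) = 4s - 2; each figure is three more than what is claimed. A cut with vertices of X on both
  sides costs X one edge if the left-out vertex lies in X, and usually two or three if it does not,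
  while the deleted edge gives one back. So cuts that keep leaving out the same vertex of X save
  nothing, and this is the obstacle. Everything depends on where the second cut leaves out its
  vertex. If it is a new vertex, one of the two pieces does not contain it and loses more. If it is
  the same vertex, the two cuts yield four pieces sharing only that vertex, a shape that is only
  refined until some later cut leaves out another vertex. Positions where a piece is barely split
  leave an edge set that is almost confined to two disjoint vertex sets, and these need estimates of
  their own.\<close>

lemma ex_subset_of_card: "n \<le> card S \<Longrightarrow> \<exists>T\<subseteq>S. card T = n"
  by (meson obtain_subset_with_card_n)

lemma partition_card_le:
  assumes "partition_on S P" "finite S"
  shows "card P \<le> card S"
proof -
  have S: "\<Union>P = S" using assms partition_onD1 by blast
  have ge: "1 \<le> card C" if "C \<in> P" for C
    using that S assms finite_subset[of C S] partition_onD3[OF assms(1)]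
    by (cases "C = {}") (auto simp: Suc_le_eq card_gt_0_iff)
  have "card P = (\<Sum>C\<in>P. 1)" by simp
  also have "\<dots> \<le> (\<Sum>C\<in>P. card C)" by (intro sum_mono ge)
  also have "\<dots> = card S"
    using product_partition[OF assms(1)] S assms(2) finite_subset[of _ S] by (metis Sup_upper)
  finally show ?thesis .
qed

section \<open>Copies of complete bipartite graphs as pairs of vertex sets\<close>

definition biclique :: "'a set \<Rightarrow> 'a set \<Rightarrow> 'a set set" where
  "biclique A B = {{a, b} | a b. a \<in> A \<and> b \<in> B}"

text \<open>The inverse isomorphism maps the two colour classes to \<open>A\<close> and
  \<open>B\<close>. From here on copies are handled as pairs of vertex sets, without
  isomorphisms.\<close>

lemma copy_complete_bipartite_biclique:
  assumes "copy_in K (complete_bipartite s t) G"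
  shows "\<exists>A B. A \<inter> B = {} \<and> A \<union> B \<subseteq> verts G \<and> card A = s \<and> card B = t
    \<and> edges K = biclique A B \<and> biclique A B \<subseteq> edges G"
proof -
  obtain f where f: "bij_betw f (verts K) ({..<s} <+> {..<t})"
    and ed: "edges (complete_bipartite s t) = (\<lambda>e. f ` e) ` edges K"
    using assms unfolding copy_in_def graph_iso_def by (auto simp: complete_bipartite_def)
  have sub: "verts K \<subseteq> verts G" "edges K \<subseteq> edges G" and simple: "simple_graph K"
    using assms unfolding copy_in_def subgraph_def by auto
  have inV: "e \<subseteq> verts K" if "e \<in> edges K" for e
    using simple that unfolding simple_graph_def complete_graph_def by auto
  define g where "g = inv_into (verts K) f"
  have g: "bij_betw g ({..<s} <+> {..<t}) (verts K)"
    unfolding g_def using f by (rule bij_betw_inv_into)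
  have gf: "g ` f ` e = e" if "e \<in> edges K" for e
    unfolding g_def using inV[OF that] f bij_betw_imp_inj_on inv_into_image_cancel by metis
  let ?A = "g ` Inl ` {..<s}" and ?B = "g ` Inr ` {..<t}"
  have inj: "inj_on g ({..<s} <+> {..<t})" using g bij_betw_imp_inj_on by blast
  have parts: "Inl ` {..<s} \<subseteq> {..<s} <+> {..<t}" "Inr ` {..<t} \<subseteq> {..<s} <+> {..<t}" by auto
  have "?A \<inter> ?B = g ` (Inl ` {..<s} \<inter> Inr ` {..<t})"
    by (rule inj_on_image_Int[OF inj parts, symmetric])
  then have 1: "?A \<inter> ?B = {}" by auto
  have 2: "?A \<union> ?B \<subseteq> verts K" using g parts unfolding bij_betw_def by blast
  have 3: "card ?A = s" "card ?B = t"
    using inj_on_subset[OF inj parts(1)] inj_on_subset[OF inj parts(2)] by (simp_all add: card_image)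
  have "edges K = (\<lambda>e. g ` f ` e) ` edges K" using gf by simp
  also have "\<dots> = (\<lambda>e. g ` e) ` edges (complete_bipartite s t)" unfolding ed by (simp add: image_image)
  also have "\<dots> = biclique ?A ?B"
  proof (rule set_eqI)
    fix e
    have "e \<in> (\<lambda>e. g ` e) ` edges (complete_bipartite s t)
        \<longleftrightarrow> (\<exists>i j. i < s \<and> j < t \<and> e = g ` {Inl i, Inr j})"
      unfolding complete_bipartite_def graph.sel by blast
    also have "\<dots> \<longleftrightarrow> e \<in> biclique ?A ?B" unfolding biclique_def by auto
    finally show "e \<in> (\<lambda>e. g ` e) ` edges (complete_bipartite s t) \<longleftrightarrow> e \<in> biclique ?A ?B" .
  qed
  finally have "edges K = biclique ?A ?B" .
  moreover from this have "biclique ?A ?B \<subseteq> edges G" using sub by simp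
  moreover have "?A \<union> ?B \<subseteq> verts G" using 2 sub(1) by (rule order_trans)
  ultimately show ?thesis using 1 3 by blast
qed

lemma biclique_copy_complete_bipartite:
  assumes "finite A" "finite B" "A \<inter> B = {}" "A \<union> B \<subseteq> verts G" "biclique A B \<subseteq> edges G"
  shows "copy_in (Graph (A \<union> B) (biclique A B)) (complete_bipartite (card A) (card B)) G"
proof -
  obtain f where f: "bij_betw f A {..<card A}"
    using ex_bij_betw_finite_nat[OF assms(1)] by (auto simp: atLeast0LessThan)
  obtain h where h: "bij_betw h B {..<card B}"
    using ex_bij_betw_finite_nat[OF assms(2)] by (auto simp: atLeast0LessThan)
  define m where "m x = (if x \<in> A then Inl (f x) else Inr (h x))" for x
  have mA: "m x = Inl (f x)" if "x \<in> A" for x using that by (simp add: m_def)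
  have mB: "m x = Inr (h x)" if "x \<in> B" for x using that assms(3) by (auto simp: m_def)
  have fA: "f ` A = {..<card A}" and hB: "h ` B = {..<card B}" using f h by (auto simp: bij_betw_def)
  have inj: "inj_on f A" "inj_on h B" using f h by (auto simp: bij_betw_def)
  have "inj_on m (A \<union> B)"
  proof (rule inj_onI)
    fix x y
    assume xy: "x \<in> A \<union> B" "y \<in> A \<union> B" "m x = m y"
    show "x = y"
      using xy inj_onD[OF inj(1), of x y] inj_onD[OF inj(2), of x y]
      unfolding m_def by (simp split: if_splits)
  qed
  moreover have "m ` (A \<union> B) = {..<card A} <+> {..<card B}"
  proof -
    have "m ` A = Inl ` f ` A" "m ` B = Inr ` h ` B" using mA mB by (auto simp: image_image)
    then show ?thesis unfolding image_Un fA hB by (simp add: Plus_def)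
  qed
  ultimately have bij: "bij_betw m (A \<union> B) ({..<card A} <+> {..<card B})"
    unfolding bij_betw_def by simp
  have "edges (complete_bipartite (card A) (card B)) = (\<lambda>e. m ` e) ` biclique A B"
  proof (rule set_eqI)
    fix e
    have "e \<in> (\<lambda>e. m ` e) ` biclique A B \<longleftrightarrow> (\<exists>a\<in>A. \<exists>b\<in>B. e = m ` {a, b})"
      unfolding biclique_def by blast
    also have "\<dots> \<longleftrightarrow> (\<exists>a\<in>A. \<exists>b\<in>B. e = {Inl (f a), Inr (h b)})" using mA mB by auto
    also have "\<dots> \<longleftrightarrow> (\<exists>i\<in>f ` A. \<exists>j\<in>h ` B. e = {Inl i, Inr j})" by auto
    also have "\<dots> \<longleftrightarrow> e \<in> edges (complete_bipartite (card A) (card B))"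
      unfolding fA hB complete_bipartite_def by auto
    finally show "e \<in> edges (complete_bipartite (card A) (card B)) \<longleftrightarrow> e \<in> (\<lambda>e. m ` e) ` biclique A B"
      by simp
  qed
  moreover have "simple_graph (Graph (A \<union> B) (biclique A B))"
    unfolding simple_graph_def complete_graph_def biclique_def using assms(1-3)
    by (simp, blast)
  ultimately show ?thesis
    unfolding copy_in_def subgraph_def graph_iso_def using bij assms(4,5)
    by (auto simp: complete_bipartite_def)
qed

lemma card_edges_complete_graph:
  assumes "finite V"
  shows "card (edges (complete_graph V)) = card V choose 2"
proof -
  have "edges (complete_graph V) = {B. B \<subseteq> V \<and> card B = 2}"
    unfolding complete_graph_def by (auto simp: card_2_iff)
  then show ?thesis using n_subsets[OF assms] by simp
qed

section \<open>Balanced cuts and edge sets that can be emptied\<close>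

locale balanced_cuts =
  fixes V :: "'a set" and s :: nat
  assumes finite_V: "finite V" and card_V: "card V = 2 * s + 1"
begin

text \<open>The left-out vertex \<open>v\<close> is the centre in the names of later lemmas. It is
  an explicit argument because the counts depend on which vertex sets contain it.\<close>

definition cut :: "'a set \<Rightarrow> 'a set \<Rightarrow> 'a \<Rightarrow> bool" where
  "cut A B v \<longleftrightarrow> A \<inter> B = {} \<and> v \<notin> A \<and> v \<notin> B \<and> insert v (A \<union> B) = V \<and> card A = s \<and> card B = s"

definition uncrossed :: "'a set \<Rightarrow> 'a set \<Rightarrow> 'a set set \<Rightarrow> bool" where
  "uncrossed A B H \<longleftrightarrow> (\<forall>a\<in>A. \<forall>b\<in>B. {a, b} \<notin> H)"

text \<open>Rules read from conclusion to premise describe the deletions, so the last rule applied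
  is the deletion carried out first.\<close>

inductive reducible :: "'a set set \<Rightarrow> bool" where
  empty: "reducible {}"
| step: "reducible H \<Longrightarrow> cut A B v \<Longrightarrow> uncrossed A B H \<Longrightarrow> a \<in> A \<Longrightarrow> b \<in> B
    \<Longrightarrow> reducible (insert {a, b} H)"

definition num :: "'a set set \<Rightarrow> 'a set \<Rightarrow> nat" where
  "num H X = card {e \<in> H. e \<subseteq> X}"

lemma cut_sym: "cut A B v \<Longrightarrow> cut B A v"
  unfolding cut_def by (auto simp: Un_commute)

lemma uncrossed_sym: "uncrossed A B H \<Longrightarrow> uncrossed B A H"
  unfolding uncrossed_def by (metis insert_commute)

lemma uncrossed_mono: "uncrossed A B H \<Longrightarrow> H' \<subseteq> H \<Longrightarrow> uncrossed A B H'"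
  unfolding uncrossed_def by blast

lemma cutD:
  assumes "cut A B v"
  shows "A \<inter> B = {}" "v \<notin> A" "v \<notin> B" "V = insert v (A \<union> B)" "card A = s" "card B = s"
    "A \<subseteq> V" "B \<subseteq> V" "v \<in> V" "finite A" "finite B"
proof -
  show "A \<inter> B = {}" "v \<notin> A" "v \<notin> B" and V: "V = insert v (A \<union> B)" and "card A = s" "card B = s"
    using assms unfolding cut_def by auto
  show "A \<subseteq> V" "B \<subseteq> V" "v \<in> V" using V by auto
  show "finite A" "finite B" using V finite_V by auto
qed

lemma reducible_finite: "reducible H \<Longrightarrow> finite H"
  by (induction rule: reducible.induct) auto

lemma reducible_edge:
  assumes "reducible H" "e \<in> H"
  obtains x y where "e = {x, y}" "x \<noteq> y" "x \<in> V" "y \<in> V"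
proof -
  have "\<exists>x y. e = {x, y} \<and> x \<noteq> y \<and> x \<in> V \<and> y \<in> V"
    using assms
  proof (induction rule: reducible.induct)
    case (step H A B v a b)
    then show ?case using cutD[OF step.hyps(2)] by blast
  qed simp
  then show ?thesis using that by blast
qed

lemma reducible_edge_subset: "reducible H \<Longrightarrow> e \<in> H \<Longrightarrow> e \<subseteq> V"
  by (metis reducible_edge empty_subsetI insert_subset)

text \<open>Exposes the edge deleted first. It crosses a cut that \<open>H'\<close> does not cross,
  hence is not in \<open>H'\<close>, and the deletion lowers the number of edges by exactly
  one.\<close>

lemma reducible_cases:
  assumes "reducible H" "H \<noteq> {}"
  obtains H' A B v a b where "H = insert {a, b} H'" "{a, b} \<notin> H'" "reducible H'" "cut A B v"
    "uncrossed A B H'" "a \<in> A" "b \<in> B"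
  using assms by (cases rule: reducible.cases) (auto simp: uncrossed_def)

text \<open>The third alternative covers an edge with an end in \<open>A \<inter> B\<close>: it
  meets both sets without running between them.\<close>

lemma uncrossed_edge:
  assumes "reducible H" "e \<in> H" "uncrossed A B H"
  shows "e \<inter> A = {} \<or> e \<inter> B = {} \<or> A \<inter> B \<noteq> {}"
proof -
  obtain x y where "e = {x, y}" using reducible_edge assms by metis
  then show ?thesis using assms unfolding uncrossed_def
    by (auto simp: insert_commute)
qed

section \<open>Counting edges inside a vertex set split by a cut\<close>

lemma num_separate:
  assumes "reducible H" "uncrossed A B H" "A \<inter> B = {}"
  shows "num H X \<le> num H (X - B) + num H (X - A)"
proof -
  have "{e \<in> H. e \<subseteq> X} \<subseteq> {e \<in> H. e \<subseteq> X - B} \<union> {e \<in> H. e \<subseteq> X - A}"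
    using uncrossed_edge[OF assms(1) _ assms(2)] assms(3) by blast
  moreover have "finite ({e \<in> H. e \<subseteq> X - B} \<union> {e \<in> H. e \<subseteq> X - A})"
    using reducible_finite[OF assms(1)] by auto
  ultimately show ?thesis unfolding num_def
    by (meson card_Un_le card_mono le_trans)
qed

lemma card_cut_in:
  assumes "cut A B v" "X \<subseteq> V" "v \<in> X"
  shows "card X = card (X \<inter> A) + card (X \<inter> B) + 1"
    "card (X - B) = card (X \<inter> A) + 1" "card (X - A) = card (X \<inter> B) + 1"
proof -
  note D = cutD[OF assms(1)]
  have f: "finite X" using finite_V assms finite_subset by blast
  have eqs: "X - B = insert v (X \<inter> A)" "X - A = insert v (X \<inter> B)" "X = insert v ((X \<inter> A) \<union> (X \<inter> B))"
    using D assms(2,3) by auto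
  show "card (X - B) = card (X \<inter> A) + 1" "card (X - A) = card (X \<inter> B) + 1"
    unfolding eqs(1,2) using f D by auto
  have "card X = card (insert v ((X \<inter> A) \<union> (X \<inter> B)))" using eqs(3) by simp
  also have "\<dots> = card ((X \<inter> A) \<union> (X \<inter> B)) + 1" using f D by auto
  also have "card ((X \<inter> A) \<union> (X \<inter> B)) = card (X \<inter> A) + card (X \<inter> B)"
    using f D by (intro card_Un_disjoint) auto
  finally show "card X = card (X \<inter> A) + card (X \<inter> B) + 1" .
qed

lemma card_cut_out:
  assumes "cut A B v" "X \<subseteq> V" "v \<notin> X"
  shows "card X = card (X \<inter> A) + card (X \<inter> B)"
    "card (X - B) = card (X \<inter> A)" "card (X - A) = card (X \<inter> B)"
proof -
  note D = cutD[OF assms(1)]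
  have f: "finite X" using finite_V assms finite_subset by blast
  have eqs: "X - B = X \<inter> A" "X - A = X \<inter> B" "X = (X \<inter> A) \<union> (X \<inter> B)"
    using D assms(2,3) by auto
  show "card (X - B) = card (X \<inter> A)" "card (X - A) = card (X \<inter> B)"
    unfolding eqs(1,2) by auto
  have "card X = card ((X \<inter> A) \<union> (X \<inter> B))" using eqs(3) by simp
  also have "\<dots> = card (X \<inter> A) + card (X \<inter> B)"
    using f D by (intro card_Un_disjoint) auto
  finally show "card X = card (X \<inter> A) + card (X \<inter> B)" .
qed

text \<open>Truncated subtraction makes the bound \<open>0\<close> for sets with at most one element.\<close>

lemma sparse:
  assumes "reducible H" "X \<subseteq> V"
  shows "num H X \<le> 2 * card X - 3"
  using assms
proof (induction arbitrary: X rule: reducible.induct)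
  case empty
  then show ?case by (simp add: num_def)
next
  case (step H A B v a b)
  note D = cutD[OF step.hyps(2)]
  have f: "finite X" using finite_V step.prems finite_subset by blast
  show ?case
  proof (cases "{a, b} \<subseteq> X")
    case False
    then have "num (insert {a, b} H) X = num H X"
      unfolding num_def by (intro arg_cong[where f = card]) auto
    then show ?thesis using step by simp
  next
    case True
    have "{e \<in> insert {a, b} H. e \<subseteq> X} = insert {a, b} {e \<in> H. e \<subseteq> X}" using True by auto
    then have "num (insert {a, b} H) X \<le> Suc (num H X)"
      unfolding num_def by (simp add: card_insert_le_m1 card_insert_if reducible_finite[OF step.hyps(1)])
    also have "num H X \<le> num H (X - B) + num H (X - A)"
      using num_separate step.hyps D by blast
    also have "num H (X - B) \<le> 2 * card (X - B) - 3" using step.IH step.prems by blast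
    also have "num H (X - A) \<le> 2 * card (X - A) - 3" using step.IH step.prems by blast
    finally have le: "num (insert {a, b} H) X \<le> Suc (2 * card (X - B) - 3 + (2 * card (X - A) - 3))"
      by simp
    \<comment> \<open>The ends of the deleted edge put p, q \<ge> 1 vertices of \<open>X\<close> on
      the two sides. With \<open>v\<close> in \<open>X\<close> the count is 1 + (2p - 1) + (2q - 1)
      = 2(p + q + 1) - 3, with no slack.\<close>
    have "card (X \<inter> A) \<ge> 1" "card (X \<inter> B) \<ge> 1"
      using f True step.hyps by (auto simp: Suc_le_eq card_gt_0_iff)
    then show ?thesis
      using le card_cut_in[OF step.hyps(2) step.prems] card_cut_out[OF step.hyps(2) step.prems]
      by (cases "v \<in> X") auto
  qed
qed

text \<open>The source of all savings. Let \<open>X\<close> have p, q \<ge> 1 vertices on the two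
  sides. Then the total falls short of 2|X| - 3 by 1 if \<open>v\<close> is in \<open>X\<close>.
  Otherwise it falls short by 3, by 2 if exactly one of p, q is 1, and by 1 if both are. This
  shortfall is called the loss below.\<close>

lemma num_split:
  assumes "reducible H" "cut A B v" "uncrossed A B H" "X \<subseteq> V"
  shows "v \<in> X \<Longrightarrow> num H X \<le> (2 * card (X \<inter> A) - 1) + (2 * card (X \<inter> B) - 1)"
    and "v \<notin> X \<Longrightarrow> num H X \<le> (2 * card (X \<inter> A) - 3) + (2 * card (X \<inter> B) - 3)"
proof -
  have "num H X \<le> num H (X - B) + num H (X - A)"
    using num_separate assms cutD(1) by blast
  also have "num H (X - B) \<le> 2 * card (X - B) - 3" using sparse assms by blast
  also have "num H (X - A) \<le> 2 * card (X - A) - 3" using sparse assms by blast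
  finally have "num H X \<le> (2 * card (X - B) - 3) + (2 * card (X - A) - 3)" by simp
  then show "v \<in> X \<Longrightarrow> num H X \<le> (2 * card (X \<inter> A) - 1) + (2 * card (X \<inter> B) - 1)"
    and "v \<notin> X \<Longrightarrow> num H X \<le> (2 * card (X \<inter> A) - 3) + (2 * card (X \<inter> B) - 3)"
    using card_cut_in[OF assms(2,4)] card_cut_out[OF assms(2,4)] by simp_all
qed

section \<open>Edge sets confined to two disjoint blobs\<close>

lemma card_le_num2:
  assumes "finite H" "\<And>e. e \<in> H \<Longrightarrow> e \<subseteq> X \<or> e \<subseteq> Y"
  shows "card H \<le> num H X + num H Y"
proof -
  have "H = {e \<in> H. e \<subseteq> X} \<union> {e \<in> H. e \<subseteq> Y}" using assms by auto
  then show ?thesis unfolding num_def using card_Un_le by metis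
qed

lemma crossed_card:
  assumes "finite X" "x \<in> X" "x \<in> A"
  shows "card (X \<inter> A) \<ge> 1"
  using assms by (auto simp: Suc_le_eq card_gt_0_iff)

text \<open>The two bounds 2s - 3 must lose 2 in total. If the centre is outside \<open>X\<close>,
  the split of \<open>X\<close> loses 2 by itself, as s \<ge> 3 excludes two single vertices. If it
  is inside, \<open>X\<close> loses 1, and \<open>Y\<close> avoids the centre and loses at least
  2.\<close>

lemma two_blobs_crossed:
  assumes s: "s \<ge> 3" and red: "reducible H" and cut: "cut A B w" and unc: "uncrossed A B H"
    and XY: "X \<subseteq> V" "Y \<subseteq> V" "X \<inter> Y = {}" "card X = s" "card Y = s"
    and ab: "a \<in> X" "a \<in> A" "b \<in> X" "b \<in> B"
  shows "num H X + num H Y + 8 \<le> 4 * s"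
proof -
  note D = cutD[OF cut]
  have fX: "finite X" "finite Y" using finite_V XY finite_subset by blast+
  have p: "card (X \<inter> A) \<ge> 1" "card (X \<inter> B) \<ge> 1" using crossed_card fX ab by metis+
  note splX = num_split[OF red cut unc XY(1)] and splY = num_split[OF red cut unc XY(2)]
  note cX = card_cut_in(1)[OF cut XY(1)] card_cut_out(1)[OF cut XY(1)]
  note cY = card_cut_in(1)[OF cut XY(2)] card_cut_out(1)[OF cut XY(2)]
  show ?thesis
  proof (cases "w \<in> X")
    case False
    have "num H Y \<le> 2 * s - 3" using sparse[OF red XY(2)] XY by simp
    moreover have "num H X + 5 \<le> 2 * s" using splX(2)[OF False] cX(2)[OF False] p s XY by linarith
    ultimately show ?thesis using s by linarith
  next
    case True
    then have wY: "w \<notin> Y" using XY by blast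
    \<comment> \<open>\<open>Y\<close> is split too: inside one side it would equal that side by
      cardinality, but both sides contain a vertex of \<open>X\<close>.\<close>
    have "Y \<noteq> A" "Y \<noteq> B" using ab XY by auto
    then have "\<not> Y \<subseteq> A" "\<not> Y \<subseteq> B" using D XY card_subset_eq by metis+
    then have "Y \<inter> B \<noteq> {}" "Y \<inter> A \<noteq> {}" using D XY wY by auto
    then have q: "card (Y \<inter> A) \<ge> 1" "card (Y \<inter> B) \<ge> 1"
      using fX by (auto simp: Suc_le_eq card_gt_0_iff)
    have "num H Y + 5 \<le> 2 * s" using splY(2)[OF wY] cY(2)[OF wY] q s XY by linarith
    moreover have "num H X + 4 \<le> 2 * s" using splX(1)[OF True] cX(1)[OF True] p s XY by linarith
    ultimately show ?thesis by linarith
  qed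
qed

text \<open>The edge deleted first lies in \<open>X\<close> or in \<open>Y\<close>, so its cut
  splits that set. The remaining edges number at most 4s - 8.\<close>

lemma two_blobs:
  assumes s: "s \<ge> 3" and red: "reducible H"
    and XY: "X \<subseteq> V" "Y \<subseteq> V" "X \<inter> Y = {}" "card X = s" "card Y = s"
    and sub: "\<And>e. e \<in> H \<Longrightarrow> e \<subseteq> X \<or> e \<subseteq> Y"
  shows "card H + 7 \<le> 4 * s"
proof (cases "H = {}")
  case False
  then obtain H' A B v a b where H: "H = insert {a, b} H'" "{a, b} \<notin> H'" "reducible H'" "cut A B v"
    "uncrossed A B H'" "a \<in> A" "b \<in> B"
    using reducible_cases red by metis
  have fin: "finite H'" using reducible_finite H by blast
  have YX: "Y \<inter> X = {}" using XY by blast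
  have "card H' \<le> num H' X + num H' Y" using sub H(1) fin by (intro card_le_num2) auto
  moreover have "num H' X + num H' Y + 8 \<le> 4 * s"
    using sub[of "{a, b}"] two_blobs_crossed[OF s H(3-5) XY, of a b] H(1,6,7)
      two_blobs_crossed[OF s H(3-5) XY(2,1) YX XY(5,4), of a b] by auto
  ultimately show ?thesis using H fin by simp
qed (use s in simp)

text \<open>The link \<open>f\<close> costs one edge whenever it disappears: if it is deleted first,
  \<open>two_blobs\<close> bounds the rest; otherwise the first cut splits a blob and
  \<open>f\<close> adds one to 4s - 8.\<close>

lemma two_blobs_link:
  assumes s: "s \<ge> 3" and red: "reducible H"
    and XY: "X \<subseteq> V" "Y \<subseteq> V" "X \<inter> Y = {}" "card X = s" "card Y = s"
    and sub: "\<And>e. e \<in> H \<Longrightarrow> e \<subseteq> X \<or> e \<subseteq> Y \<or> e = f"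
  shows "card H + 6 \<le> 4 * s"
proof (cases "H = {}")
  case False
  then obtain H' A B v a b where H: "H = insert {a, b} H'" "{a, b} \<notin> H'" "reducible H'" "cut A B v"
    "uncrossed A B H'" "a \<in> A" "b \<in> B"
    using reducible_cases red by metis
  have fin: "finite H'" using reducible_finite H by blast
  have YX: "Y \<inter> X = {}" using XY by blast
  show ?thesis
  proof (cases "{a, b} \<subseteq> X \<or> {a, b} \<subseteq> Y")
    case False
    then have "card H' + 7 \<le> 4 * s"
      using two_blobs[OF s H(3) XY] sub H by blast
    then show ?thesis using H fin by simp
  next
    case True
    have "card (H' - {f}) \<le> num (H' - {f}) X + num (H' - {f}) Y"
      using sub H(1) fin by (intro card_le_num2) auto
    also have "\<dots> \<le> num H' X + num H' Y"
      unfolding num_def using fin by (intro add_mono card_mono) auto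
    finally have "card H' \<le> num H' X + num H' Y + 1"
      using fin by (metis add.commute add_le_cancel_right card_Diff1_le card_Diff_singleton_if
          diff_le_self le_diff_conv le_trans)
    moreover have "num H' X + num H' Y + 8 \<le> 4 * s"
      using True two_blobs_crossed[OF s H(3-5) XY, of a b] H(6,7)
        two_blobs_crossed[OF s H(3-5) XY(2,1) YX XY(5,4), of a b] by auto
    ultimately show ?thesis using H fin by simp
  qed
qed (use s in simp)

text \<open>The bounds for \<open>X\<close> and \<open>T\<close> add up to 4s - 4, and three of
  these edges must be lost once the first edge is deleted. The loss comes from splitting both sets,
  or from \<open>two_blobs\<close> if the cut does not split \<open>X\<close>.\<close>

lemma large_blob:
  assumes s: "s \<ge> 3" and red: "reducible H"
    and XT: "X \<inter> T = {}" "X \<union> T = V" "card X = s" "card T = s + 1"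
    and sub: "\<And>e. e \<in> H \<Longrightarrow> e \<subseteq> X \<or> e \<subseteq> T"
  shows "card H + 6 \<le> 4 * s"
proof (cases "H = {}")
  case False
  then obtain H' A B w a b where H: "H = insert {a, b} H'" "{a, b} \<notin> H'" "reducible H'" "cut A B w"
    "uncrossed A B H'" "a \<in> A" "b \<in> B"
    using reducible_cases red by metis
  note D = cutD[OF H(4)]
  have fin: "finite H'" using reducible_finite H by blast
  have XV: "X \<subseteq> V" "T \<subseteq> V" using XT by auto
  have fX: "finite X" "finite T" using finite_V XV finite_subset by blast+
  have sub': "e \<subseteq> X \<or> e \<subseteq> T" if "e \<in> H'" for e using sub H that by blast
  have cH: "card H' \<le> num H' X + num H' T" using sub' fin by (intro card_le_num2) auto
  note splX = num_split[OF H(3,4,5) XV(1)] and splT = num_split[OF H(3,4,5) XV(2)]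
  note cX = card_cut_in(1)[OF H(4) XV(1)] card_cut_out(1)[OF H(4) XV(1)]
  note cT = card_cut_in(1)[OF H(4) XV(2)] card_cut_out(1)[OF H(4) XV(2)]
  have cA: "card (X \<inter> A) + card (T \<inter> A) = s" and cB: "card (X \<inter> B) + card (T \<inter> B) = s"
  proof -
    have "card (X \<inter> A \<union> T \<inter> A) = card (X \<inter> A) + card (T \<inter> A)"
      using XT fX by (intro card_Un_disjoint) auto
    moreover have "X \<inter> A \<union> T \<inter> A = A" using XT D by auto
    ultimately show "card (X \<inter> A) + card (T \<inter> A) = s" using D by simp
    have "card (X \<inter> B \<union> T \<inter> B) = card (X \<inter> B) + card (T \<inter> B)"
      using XT fX by (intro card_Un_disjoint) auto
    moreover have "X \<inter> B \<union> T \<inter> B = B" using XT D by auto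
    ultimately show "card (X \<inter> B) + card (T \<inter> B) = s" using D by simp
  qed
  have "card H' + 7 \<le> 4 * s"
  proof (cases "w \<in> X")
    case True
    then have wT: "w \<notin> T" using XT by blast
    \<comment> \<open>A side \<open>P\<close> that misses \<open>X\<close> fills \<open>T\<close>
      except for one vertex \<open>y\<close>. The other side contains \<open>y\<close>, so no
      remaining edge joins \<open>y\<close> to \<open>P\<close>, and \<open>X\<close> and
      \<open>P\<close> are two blobs of size s.\<close>
    have two: "card H' + 7 \<le> 4 * s"
      if Q: "card (X \<inter> P) = 0" "cut P Q w" "uncrossed P Q H'" for P Q
    proof -
      note DQ = cutD[OF Q(2)]
      have XP: "X \<inter> P = {}" using Q fX by simp
      then have PT: "P \<subseteq> T" using DQ XT by blast
      show ?thesis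
      proof (rule two_blobs[OF s H(3) XV(1) _ _ XT(3)])
        show "P \<subseteq> V" "X \<inter> P = {}" "card P = s" using DQ XP by auto
        have "card (T - P) = 1" using PT DQ XT fX by (simp add: card_Diff_subset)
        then obtain y where y: "T - P = {y}" by (meson card_1_singletonE)
        show "e \<subseteq> X \<or> e \<subseteq> P" if e: "e \<in> H'" for e
        proof -
          obtain x z where xz: "e = {x, z}" "x \<noteq> z" using reducible_edge H(3) e by metis
          have "e \<subseteq> P" if T: "e \<subseteq> T"
          proof (rule ccontr)
            assume "\<not> e \<subseteq> P"
            then have "y \<in> e" "e \<inter> P \<noteq> {}" using T y xz by auto
            moreover have "y \<in> Q" using y wT DQ XV by blast
            ultimately show False using uncrossed_edge[OF H(3) e Q(3)] DQ by blast
          qed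
          then show ?thesis using sub'[OF e] by blast
        qed
      qed
    qed
    consider "card (X \<inter> A) = 0" | "card (X \<inter> B) = 0" | "card (X \<inter> A) \<ge> 1" "card (X \<inter> B) \<ge> 1"
      by linarith
    then show ?thesis
    proof cases
      case 1 then show ?thesis using two H by blast
    next
      case 2 then show ?thesis using two H cut_sym uncrossed_sym by blast
    next
      case 3
      \<comment> \<open>Each side has at most s - 2 vertices in \<open>X\<close>, hence at least two
        in \<open>T\<close>: \<open>X\<close> loses 1 and \<open>T\<close> loses 3.\<close>
      then show ?thesis
        using cH splX(1)[OF True] splT(2)[OF wT] cX(1)[OF True] cT(2)[OF wT] cA cB XT s by linarith
    qed
  next
    case False
    then have wT: "w \<in> T" using XT D by blast
    show ?thesis
    proof (cases "card (X \<inter> A) \<ge> 1 \<and> card (X \<inter> B) \<ge> 1")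
      case True
      then show ?thesis
        using cH splX(2)[OF False] splT(1)[OF wT] cX(2)[OF False] cT(1)[OF wT] cA cB XT s by linarith
    next
      case nc: False
      have "X \<inter> A = {} \<or> X \<inter> B = {}" using nc fX by (auto simp: Suc_le_eq card_gt_0_iff)
      then have "X \<subseteq> B \<or> X \<subseteq> A" using D XV False by blast
      then have "X = A \<or> X = B" using D XT card_subset_eq by metis
      \<comment> \<open>The deleted edge would run between \<open>X\<close> and \<open>T\<close>,
        contrary to \<open>sub\<close>.\<close>
      then show ?thesis using sub[of "{a, b}"] H D XT by auto
    qed
  qed
  then show ?thesis using H fin by simp
qed (use s in simp)

section \<open>Edge sets whose pieces share one vertex, the hub\<close>

lemma sum_min_2:
  fixes f :: "'b \<Rightarrow> nat"
  assumes "finite D"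
  shows "min (sum f D) 2 \<le> (\<Sum>C\<in>D. min (f C) 2)"
  using assms by (induction rule: finite_induct) auto

text \<open>A nonzero term and the sum of the others are both positive and total at least 3, so
  capping each of the two at 2 still leaves 3.\<close>

lemma sum_min_3:
  fixes f :: "'b \<Rightarrow> nat"
  assumes fin: "finite D" and ge: "sum f D \<ge> 3" and lt: "\<And>C. C \<in> D \<Longrightarrow> f C < sum f D"
  shows "3 \<le> (\<Sum>C\<in>D. min (f C) 2)"
proof -
  obtain C where C: "C \<in> D" "f C \<noteq> 0" using ge fin by (metis not_numeral_le_zero sum.neutral)
  have "(\<Sum>C\<in>D. min (f C) 2) = min (f C) 2 + (\<Sum>C\<in>D - {C}. min (f C) 2)"
    using fin C by (simp add: sum.remove)
  moreover have "min (sum f (D - {C})) 2 \<le> (\<Sum>C\<in>D - {C}. min (f C) 2)"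
    using fin by (intro sum_min_2) auto
  moreover have "sum f D = f C + sum f (D - {C})" using fin C by (simp add: sum.remove)
  ultimately show ?thesis using lt[OF C(1)] C(2) ge by linarith
qed

text \<open>The bounds 2|C| - 1 for the sets \<open>insert v C\<close> add up to 4s - |P|. Each of
  these sets meets \<open>B\<close> in \<open>v\<close>, so the cut splits every one that has a
  vertex in \<open>A\<close>. As |A| = s \<ge> 3 and no part holds all of \<open>A\<close>, the
  total loss is at least 3.\<close>

lemma hub_off_centre:
  assumes s: "s \<ge> 3" and red: "reducible H" and v: "v \<in> V" and P: "partition_on (V - {v}) P"
    and small: "\<And>C. C \<in> P \<Longrightarrow> card C < s"
    and sub: "\<And>e. e \<in> H \<Longrightarrow> \<exists>C\<in>P. e \<subseteq> insert v C"
    and cut: "cut A B w" and unc: "uncrossed A B H" and vB: "v \<in> B"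
  shows "card H + card P + 3 \<le> 4 * s"
proof -
  note D = cutD[OF cut]
  have UP: "\<Union>P = V - {v}" using P partition_onD1 by blast
  have dis: "C \<inter> C' = {}" if "C \<in> P" "C' \<in> P" "C \<noteq> C'" for C C'
    using partition_onD2[OF P] that unfolding disjoint_def by blast
  have finP: "finite P" using finite_elements[OF _ P] finite_V by simp
  have fin: "finite C" if "C \<in> P" for C using UP that finite_V by (metis Diff_subset Sup_upper finite_subset)
  have sumV: "(\<Sum>C\<in>P. card C) = 2 * s"
  proof -
    have "card (\<Union>C\<in>P. C) = (\<Sum>C\<in>P. card C)"
      using finP fin dis by (intro card_UN_disjoint) auto
    then show ?thesis using UP v card_V finite_V by simp
  qed
  have sumA: "(\<Sum>C\<in>P. card (C \<inter> A)) = s"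
  proof -
    have "card (\<Union>C\<in>P. C \<inter> A) = (\<Sum>C\<in>P. card (C \<inter> A))"
      using finP fin dis by (intro card_UN_disjoint) (simp, simp, blast)
    moreover have "A \<subseteq> \<Union>P" using UP D(1,7) vB by blast
    then have "(\<Union>C\<in>P. C \<inter> A) = A" by blast
    ultimately show ?thesis using D by simp
  qed
  have "w \<in> \<Union>P" using UP D(3,9) vB by blast
  then obtain K where K: "K \<in> P" "w \<in> K" by blast
  \<comment> \<open>A lower estimate of the loss on \<open>insert v C\<close>. The cap is 1 for the
    part that contains the centre \<open>w\<close>. Elsewhere a single vertex in \<open>A\<close>
    counts only 1 because \<open>C\<close> may consist of it alone.\<close>
  define loss where "loss C = (if C = K then min (card (C \<inter> A)) 1 else min (card (C \<inter> A)) 2)" for C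
  have bound: "num H (insert v C) + 1 + loss C \<le> 2 * card C" if C: "C \<in> P" for C
  proof -
    have CV: "insert v C \<subseteq> V" "v \<notin> C" using UP C v by auto
    have cC: "card (insert v C) = card C + 1" using CV fin[OF C] by simp
    have C0: "card C \<ge> 1"
      using fin[OF C] partition_onD3[OF P] C by (cases "C = {}") (auto simp: Suc_le_eq card_gt_0_iff)
    have IA: "insert v C \<inter> A = C \<inter> A" using vB D by blast
    have q: "card (insert v C \<inter> B) \<ge> 1" using crossed_card[of "insert v C" v B] vB fin[OF C] by simp
    have sp: "num H (insert v C) \<le> 2 * (card C + 1) - 3" using sparse[OF red CV(1)] cC by simp
    note spl = num_split[OF red cut unc CV(1), unfolded IA]
    note cc = card_cut_in(1)[OF cut CV(1), unfolded IA cC] card_cut_out(1)[OF cut CV(1), unfolded IA cC]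
    show ?thesis
    proof (cases "card (C \<inter> A) = 0")
      case True
      have "loss C = 0" unfolding loss_def True by simp
      then show ?thesis using sp C0 by simp
    next
      case False
      show ?thesis
      proof (cases "C = K")
        case True
        have w: "w \<in> insert v C" using True K(2) by simp
        have "loss C = 1" unfolding loss_def using True False by simp
        then show ?thesis using spl(1)[OF w] cc(1)[OF w] q False by linarith
      next
        case ne: False
        then have w: "w \<notin> insert v C" using dis[OF C K(1)] K(2) vB D(3) by blast
        have "loss C = min (card (C \<inter> A)) 2" using ne by (simp add: loss_def)
        then show ?thesis using spl(2)[OF w] cc(2)[OF w] q False by linarith
      qed
    qed
  qed
  have "H = (\<Union>C\<in>P. {e \<in> H. e \<subseteq> insert v C})" using sub by blast
  then have "card H \<le> (\<Sum>C\<in>P. num H (insert v C))"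
    unfolding num_def using card_UN_le[OF finP, of "\<lambda>C. {e \<in> H. e \<subseteq> insert v C}"] by simp
  moreover have "(\<Sum>C\<in>P. num H (insert v C) + 1 + loss C) \<le> (\<Sum>C\<in>P. 2 * card C)"
    by (intro sum_mono bound)
  moreover have "(\<Sum>C\<in>P. num H (insert v C) + 1 + loss C)
      = (\<Sum>C\<in>P. num H (insert v C)) + card P + sum loss P"
    by (simp only: sum.distrib card_eq_sum)
  moreover have "(\<Sum>C\<in>P. 2 * card C) = 4 * s"
    using sumV by (simp flip: sum_distrib_left)
  ultimately have total: "card H + card P + sum loss P \<le> 4 * s" by linarith
  let ?D = "P - {K}"
  have lossP: "sum loss P = min (card (K \<inter> A)) 1 + (\<Sum>C\<in>?D. min (card (C \<inter> A)) 2)"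
    using finP K by (simp add: sum.remove loss_def)
  have rest: "card (K \<inter> A) + (\<Sum>C\<in>?D. card (C \<inter> A)) = s"
    using sumA finP K by (simp add: sum.remove)
  have "K \<inter> A \<subset> K" using K(2) D(2) by blast
  then have "card (K \<inter> A) < card K" using fin K psubset_card_mono by blast
  \<comment> \<open>\<open>K\<close> has fewer than s vertices and one of them, \<open>w\<close>, is
    outside \<open>A\<close>; so at least two vertices of \<open>A\<close> lie in other
    parts.\<close>
  then have Ks: "card (K \<inter> A) + 2 \<le> s" using small[OF K(1)] by linarith
  have "sum loss P \<ge> 3"
  proof (cases "card (K \<inter> A) = 0")
    case True
    have "card (C \<inter> A) < s" if "C \<in> P" for C
      using small[OF that] card_mono[OF fin[OF that], of "C \<inter> A"] by simp
    then have "3 \<le> (\<Sum>C\<in>?D. min (card (C \<inter> A)) 2)"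
      using finP rest True s by (intro sum_min_3) auto
    then show ?thesis using lossP by linarith
  next
    case False
    then show ?thesis
      using sum_min_2[of ?D "\<lambda>C. card (C \<inter> A)"] finP rest Ks lossP by simp
  qed
  then show ?thesis using total by linarith
qed

text \<open>If the last cut leaves out \<open>v\<close> too, it refines \<open>P\<close> by one part, which pays for the edge that
  it removes; otherwise it already separates enough of the parts.\<close>

lemma hub:
  assumes "reducible H" and s: "s \<ge> 3" and v: "v \<in> V" and "partition_on (V - {v}) P"
    and "\<And>C. C \<in> P \<Longrightarrow> card C < s"
    and "\<And>e. e \<in> H \<Longrightarrow> \<exists>C\<in>P. e \<subseteq> insert v C"
  shows "card H + card P + 2 \<le> 4 * s"
  using assms(1,4-)
proof (induction arbitrary: P rule: reducible.induct)
  case empty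
  \<comment> \<open>There are at most 2s parts, and 2s + 2 \<le> 4s.\<close>
  have "card P \<le> card (V - {v})" using partition_card_le[OF empty(1)] finite_V by simp
  then show ?case using v card_V finite_V s by simp
next
  case (step H A B w a b)
  note D = cutD[OF step.hyps(2)]
  have nin: "{a, b} \<notin> H" using step.hyps unfolding uncrossed_def by blast
  have sub: "\<exists>C\<in>P. e \<subseteq> insert v C" if "e \<in> H" for e using step.prems(3) that by blast
  have finH: "finite H" using reducible_finite step.hyps by blast
  consider "v \<in> B" | "v \<in> A" | "v = w" using v D by blast
  then have "card H + card P + 3 \<le> 4 * s"
  proof cases
    case 1
    then show ?thesis
      using hub_off_centre[OF s step.hyps(1) v step.prems(1,2) sub step.hyps(2,3)] by blast
  next
    case 2
    then show ?thesis
      using hub_off_centre[OF s step.hyps(1) v step.prems(1,2) sub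
          cut_sym[OF step.hyps(2)] uncrossed_sym[OF step.hyps(3)]] by blast
  next
    case 3
    obtain C where C: "C \<in> P" "{a, b} \<subseteq> insert v C" using step.prems(3) by blast
    have UP: "\<Union>P = V - {v}" using partition_onD1[OF step.prems(1)] by simp
    have dis: "X \<inter> Y = {}" if "X \<in> P" "Y \<in> P" "X \<noteq> Y" for X Y
      using partition_onD2[OF step.prems(1)] that unfolding disjoint_def by blast
    have finP: "finite P" using finite_elements[OF _ step.prems(1)] finite_V by simp
    let ?Q = "{C \<inter> A, C \<inter> B} \<union> (P - {C})"
    \<comment> \<open>The centre is \<open>v\<close>, so neither end of the deleted edge is
      \<open>v\<close>: both halves of \<open>C\<close> are nonempty and the number of parts grows
      by exactly one.\<close>
    have ab: "a \<in> C \<inter> A" "b \<in> C \<inter> B" using C(2) 3 D(2,3) step.hyps(4,5) by auto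
    have CAB: "C \<subseteq> A \<union> B" using UP C(1) D(4) 3 by blast
    have notin: "C \<inter> A \<notin> P - {C}" "C \<inter> B \<notin> P - {C}" using dis[OF C(1)] ab by blast+
    have ne: "C \<inter> A \<noteq> C \<inter> B" using ab D(1) by blast
    have "card ?Q = card {C \<inter> A, C \<inter> B} + card (P - {C})"
      using notin finP by (intro card_Un_disjoint) auto
    then have cardQ: "card ?Q = card P + 1"
      using ne C(1) finP card_Suc_Diff1[OF finP C(1)] by simp
    have "card H + card ?Q + 2 \<le> 4 * s"
    proof (rule step.IH)
      show "partition_on (V - {v}) ?Q"
      proof (rule partition_onI)
        show "\<Union>?Q = V - {v}" unfolding UP[symmetric] using CAB C(1) by auto
        show "disjnt X Y" if "X \<in> ?Q" "Y \<in> ?Q" "X \<noteq> Y" for X Y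
          using that dis C(1) D(1) unfolding disjnt_def by blast
        show "{} \<notin> ?Q"
          using ab partition_onD3[OF step.prems(1)] by auto
      qed
      have finC: "finite C" using UP C(1) finite_V by (metis Diff_subset Sup_upper finite_subset)
      have "card (C \<inter> A) < s" "card (C \<inter> B) < s"
        using step.prems(2)[OF C(1)] card_mono[OF finC, of "C \<inter> A"] card_mono[OF finC, of "C \<inter> B"] by auto
      then show "card X < s" if "X \<in> ?Q" for X using that step.prems(2) by auto
      show "\<exists>X\<in>?Q. e \<subseteq> insert v X" if e: "e \<in> H" for e
      proof -
        obtain X where X: "X \<in> P" "e \<subseteq> insert v X" using sub e by blast
        have "e \<inter> A = {} \<or> e \<inter> B = {}" using uncrossed_edge[OF step.hyps(1) e step.hyps(3)] D(1) by blast
        then have "X = C \<Longrightarrow> e \<subseteq> insert v (C \<inter> B) \<or> e \<subseteq> insert v (C \<inter> A)"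
          using X(2) CAB by auto
        then show ?thesis using X by auto
      qed
    qed
    then show ?thesis using cardQ by simp
  qed
  then show ?case using nin finH by simp
qed

section \<open>Two uncrossed cuts and the upper bound\<close>

text \<open>The pieces \<open>insert v A\<close> and \<open>insert v B\<close> allow 4s - 2 edges,
  so the second cut has to lose 4. Exactly one piece contains \<open>w\<close>. In general that
  piece loses 1 and the other loses 3, unless a single vertex is split off from the other; then the
  edges have the shape required by \<open>two_blobs_link\<close> or
  \<open>large_blob\<close>.\<close>

lemma second_cut_off_centre:
  assumes s: "s \<ge> 3" and red: "reducible H"
    and cut: "cut A B v" and unc: "uncrossed A B H"
    and cut': "cut A' B' w" and unc': "uncrossed A' B' H"
    and vB: "v \<in> B'" and ab: "a \<in> A'" "a \<in> insert v A"
  shows "card H + 6 \<le> 4 * s"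
proof -
  note D = cutD[OF cut] and D' = cutD[OF cut']
  let ?S = "insert v A" and ?T = "insert v B"
  have SV: "?S \<subseteq> V" "?T \<subseteq> V" using D by auto
  have edge: "e \<subseteq> ?S \<or> e \<subseteq> ?T" if "e \<in> H" for e
    using uncrossed_edge[OF red that unc] reducible_edge_subset[OF red that] D(1,4) by auto
  have edge': "e \<inter> A' = {} \<or> e \<inter> B' = {}" if "e \<in> H" for e
    using uncrossed_edge[OF red that unc'] D'(1) by blast
  have cH: "card H \<le> num H ?S + num H ?T" using edge reducible_finite[OF red] by (intro card_le_num2)
  have vA': "v \<notin> A'" and wv: "w \<noteq> v" using vB D' by auto
  have I: "?S \<inter> A' = A \<inter> A'" "?T \<inter> A' = B \<inter> A'"
    "?S \<inter> B' = insert v (A \<inter> B')" "?T \<inter> B' = insert v (B \<inter> B')" using vB vA' by auto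
  have cI: "card (?S \<inter> B') = card (A \<inter> B') + 1" "card (?T \<inter> B') = card (B \<inter> B') + 1"
    unfolding I using D by auto
  note splS = num_split[OF red cut' unc' SV(1), unfolded cI, unfolded I]
  note splT = num_split[OF red cut' unc' SV(2), unfolded cI, unfolded I]
  have cA': "card (A \<inter> A') + card (B \<inter> A') = s"
    using card_cut_out(1)[OF cut D'(7) vA'] D' by (simp add: Int_commute)
  have cB': "card (A \<inter> B') + card (B \<inter> B') + 1 = s"
    using card_cut_in(1)[OF cut D'(8) vB] D' by (simp add: Int_commute)
  have pos: "card (A \<inter> A') \<ge> 1" using crossed_card[of A a A'] ab vA' D by auto
  note cA = card_cut_in(1)[OF cut' D(7)] card_cut_out(1)[OF cut' D(7)]
  note cB = card_cut_in(1)[OF cut' D(8)] card_cut_out(1)[OF cut' D(8)]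
  have wAB: "w \<in> A \<or> w \<in> B" using wv D D' by blast
  show ?thesis
  proof (cases "w \<in> A")
    case True
    then have wB: "w \<notin> B" "w \<notin> ?T" using D wv by auto
    show ?thesis
    proof (cases "card (B \<inter> A') \<ge> 2")
      case ge2: True
      show ?thesis
        using cH splS(1) splT(2)[OF wB(2)] cA(1)[OF True] cB(2)[OF wB(1)] cA' cB' D pos s ge2 True
        by simp
    next
      case False
      then have c1: "card (B \<inter> A') = 1" "card (A \<inter> B') = 0"
        using cA(1)[OF True] cB(2)[OF wB(1)] cA' cB' D pos by linarith+
      then have e: "A \<inter> B' = {}" using D by simp
      obtain y where y: "B \<inter> A' = {y}" using c1 by (meson card_1_singletonE)
      have Y: "?T - A' = ?T - {y}" "y \<in> ?T" using y vA' by auto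
      show ?thesis
      \<comment> \<open>All of \<open>A\<close> except \<open>w\<close> lies in \<open>A'\<close>
        while \<open>v\<close> is in \<open>B'\<close>, so the only possible edge from
        \<open>v\<close> to \<open>A\<close> is \<open>{v, w}\<close>. The vertex \<open>y\<close>
        has no edge to the rest of \<open>?T\<close>, which lies in \<open>B'\<close>.\<close>
      proof (rule two_blobs_link[OF s red D(7), where Y = "?T - A'" and f = "{v, w}"])
        show "?T - A' \<subseteq> V" "A \<inter> (?T - A') = {}" "card A = s" using SV D by auto
        show "card (?T - A') = s" unfolding Y(1) using Y(2) D by simp
        have F: "A \<subseteq> insert w A'" "?T - {y} \<subseteq> B'"
          using D(7) SV(2) D'(4) e wB(2) y vA' by auto
        show "h \<subseteq> A \<or> h \<subseteq> ?T - A' \<or> h = {v, w}" if h: "h \<in> H" for h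
        proof -
          obtain p q where pq: "h = {p, q}" "p \<noteq> q" using reducible_edge[OF red h] .
          show ?thesis using edge[OF h]
          proof
            assume "h \<subseteq> ?S"
            then show ?thesis using F(1) edge'[OF h] vB pq by auto
          next
            assume "h \<subseteq> ?T"
            then show ?thesis using F(2) edge'[OF h] pq by auto
          qed
        qed
      qed
    qed
  next
    case False
    then have wB: "w \<in> B" and wS: "w \<notin> ?S" and wT: "w \<in> ?T" using wAB wv by auto
    consider "card (A \<inter> B') = 0" | "card (A \<inter> A') \<ge> 2" "card (A \<inter> B') \<ge> 1"
      | "card (A \<inter> A') = 1" using pos by linarith
    then show ?thesis
    proof cases
      case 1
      then have e: "A \<inter> B' = {}" using D by simp
      show ?thesis
      \<comment> \<open>\<open>A\<close> lies in \<open>A'\<close> and \<open>v\<close> in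
        \<open>B'\<close>, so no edge joins \<open>v\<close> to \<open>A\<close>.\<close>
      proof (rule large_blob[OF s red, where X = A and T = ?T])
        show "A \<inter> ?T = {}" "A \<union> ?T = V" "card A = s" "card ?T = s + 1" using D by auto
        have "A \<subseteq> A'" using D(7) D'(4) e wS by auto
        then show "h \<subseteq> A \<or> h \<subseteq> ?T" if h: "h \<in> H" for h
          using edge[OF h] edge'[OF h] vB by auto
      qed
    next
      case 2
      then show ?thesis
        using cH splS(2)[OF wS] splT(1)[OF wT] cA(2)[OF False] cB(1)[OF wB] cA' cB' D s by simp
    next
      case 3
      then have "card (B \<inter> B') = 0" using cA(2)[OF False] cB' D by linarith
      then have e: "B \<inter> B' = {}" using D by simp
      obtain y where y: "A \<inter> A' = {y}" using 3 by (meson card_1_singletonE)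
      have Y: "?S - A' = ?S - {y}" "y \<in> ?S" using y vA' by auto
      show ?thesis
      \<comment> \<open>The pieces have exchanged roles: all of \<open>B\<close> except
        \<open>w\<close> lies in \<open>A'\<close>, and \<open>y\<close> has no edge to the rest of
        \<open>?S\<close>.\<close>
      proof (rule two_blobs_link[OF s red _ D(8), where X = "?S - A'" and f = "{v, w}"])
        show "?S - A' \<subseteq> V" "(?S - A') \<inter> B = {}" "card B = s" using SV D by auto
        show "card (?S - A') = s" unfolding Y(1) using Y(2) D by simp
        have F: "B \<subseteq> insert w A'" "?S - {y} \<subseteq> B'"
          using D(8) SV(1) D'(4) e wS y vA' by auto
        show "h \<subseteq> ?S - A' \<or> h \<subseteq> B \<or> h = {v, w}" if h: "h \<in> H" for h
        proof -
          obtain p q where pq: "h = {p, q}" "p \<noteq> q" using reducible_edge[OF red h] .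
          show ?thesis using edge[OF h]
          proof
            assume "h \<subseteq> ?T"
            then show ?thesis using F(1) edge'[OF h] vB pq by auto
          next
            assume "h \<subseteq> ?S"
            then show ?thesis using F(2) edge'[OF h] pq by auto
          qed
        qed
      qed
    qed
  qed
qed

text \<open>\<open>a\<close> and \<open>b\<close> place vertices of \<open>A\<close> on both sides
  of the second cut. As all four sides have s vertices, the four intersections are nonempty and
  smaller than s. They are the parts around the hub \<open>v\<close>, and \<open>hub\<close> with
  four parts gives 4 + 2 = 6.\<close>

lemma second_cut_at_centre:
  assumes s: "s \<ge> 3" and red: "reducible H"
    and cut: "cut A B v" and unc: "uncrossed A B H"
    and cut': "cut A' B' v" and unc': "uncrossed A' B' H"
    and ab: "a \<in> A'" "b \<in> B'" "a \<in> A" "b \<in> A"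
  shows "card H + 6 \<le> 4 * s"
proof -
  note D = cutD[OF cut] and D' = cutD[OF cut']
  let ?P = "{A \<inter> A', A \<inter> B', B \<inter> A', B \<inter> B'}"
  have cs: "card (A \<inter> A') + card (A \<inter> B') = s" "card (B \<inter> A') + card (B \<inter> B') = s"
    "card (A \<inter> A') + card (B \<inter> A') = s"
    using card_cut_out(1)[OF cut' D(7,2)] card_cut_out(1)[OF cut' D(8,3)]
      card_cut_out(1)[OF cut D'(7,2)] D D' by (simp_all add: Int_commute)
  have pos: "card (A \<inter> A') \<ge> 1" "card (A \<inter> B') \<ge> 1" using crossed_card ab D by metis+
  then have pos': "card (B \<inter> A') \<ge> 1" "card (B \<inter> B') \<ge> 1" using cs by linarith+
  have ne: "A \<inter> A' \<noteq> {}" "A \<inter> B' \<noteq> {}" "B \<inter> A' \<noteq> {}" "B \<inter> B' \<noteq> {}" using pos pos' by auto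
  have "card H + card ?P + 2 \<le> 4 * s"
  proof (rule hub[OF red s D(9)])
    show "partition_on (V - {v}) ?P"
    proof (rule partition_onI)
      show "\<Union>?P = V - {v}" using D(2-4,7,8) D'(4) by auto
      show "disjnt X Y" if "X \<in> ?P" "Y \<in> ?P" "X \<noteq> Y" for X Y
        using that D(1) D'(1) unfolding disjnt_def by blast
      show "{} \<notin> ?P" using ne by auto
    qed
    show "card X < s" if "X \<in> ?P" for X using that cs pos pos' by auto
    show "\<exists>X\<in>?P. h \<subseteq> insert v X" if h: "h \<in> H" for h
    proof -
      have "h \<inter> A = {} \<or> h \<inter> B = {}" "h \<inter> A' = {} \<or> h \<inter> B' = {}"
        using uncrossed_edge[OF red h unc] uncrossed_edge[OF red h unc'] D(1) D'(1) by auto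
      moreover have "h \<subseteq> insert v (A \<union> B)" "h \<subseteq> insert v (A' \<union> B')"
        using reducible_edge_subset[OF red h] D(4) D'(4) by auto
      ultimately have "h \<subseteq> insert v (A \<inter> A') \<or> h \<subseteq> insert v (A \<inter> B')
          \<or> h \<subseteq> insert v (B \<inter> A') \<or> h \<subseteq> insert v (B \<inter> B')" by blast
      then show ?thesis by auto
    qed
  qed
  moreover have "card ?P = 4"
  proof -
    have "A \<inter> A' \<noteq> A \<inter> B'" "A \<inter> A' \<noteq> B \<inter> A'" "A \<inter> A' \<noteq> B \<inter> B'" "A \<inter> B' \<noteq> B \<inter> A'"
      "A \<inter> B' \<noteq> B \<inter> B'" "B \<inter> A' \<noteq> B \<inter> B'" using ne D(1) D'(1) by blast+
    then show ?thesis by simp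
  qed
  ultimately show ?thesis by simp
qed

text \<open>The edge deleted first lies inside one piece of the given cut, so its own cut is a
  second one that splits this piece. The remaining edges cross neither cut, and the position of
  \<open>v\<close> in the second cut selects the estimate.\<close>

lemma second_cut:
  assumes s: "s \<ge> 3" and red: "reducible H" and cut: "cut A B v" and unc: "uncrossed A B H"
  shows "card H + 5 \<le> 4 * s"
proof (cases "H = {}")
  case False
  then obtain H' A' B' w a b where H: "H = insert {a, b} H'" "{a, b} \<notin> H'" "reducible H'" "cut A' B' w"
    "uncrossed A' B' H'" "a \<in> A'" "b \<in> B'"
    using reducible_cases red by metis
  note D = cutD[OF cut] and D' = cutD[OF H(4)]
  have "card H' + 6 \<le> 4 * s"
    if C: "cut A B v" "uncrossed A B H" "cut A' B' w" "uncrossed A' B' H'" "a \<in> A'" "b \<in> B'"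
      "{a, b} \<subseteq> insert v A" for A B A' B' a b
  proof -
    note D = cutD[OF C(1)] and D' = cutD[OF C(3)]
    have unc: "uncrossed A B H'" using C(2) H(1) uncrossed_mono by blast
    consider "v = w" | "v \<in> B'" | "v \<in> A'" using D D' by blast
    then show ?thesis
    proof cases
      case 1
      then show ?thesis
        using second_cut_at_centre[OF s H(3) C(1) unc C(3)[folded 1] C(4)] C D' by blast
    next
      case 2
      then show ?thesis using second_cut_off_centre[OF s H(3) C(1) unc C(3,4)] C by blast
    next
      case 3
      then show ?thesis
        using second_cut_off_centre[OF s H(3) C(1) unc cut_sym[OF C(3)] uncrossed_sym[OF C(4)]] C by blast
    qed
  qed note main = this
  have "{a, b} \<in> H" using H by blast
  then have "{a, b} \<subseteq> insert v A \<or> {a, b} \<subseteq> insert v B"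
    using uncrossed_edge[OF red \<open>{a, b} \<in> H\<close> unc] reducible_edge_subset[OF red \<open>{a, b} \<in> H\<close>] D(1,4)
    by auto
  then have "card H' + 6 \<le> 4 * s"
  proof
    assume "{a, b} \<subseteq> insert v A"
    then show ?thesis by (rule main[OF cut unc H(4-7)])
  next
    assume "{a, b} \<subseteq> insert v B"
    then show ?thesis by (rule main[OF cut_sym[OF cut] uncrossed_sym[OF unc] H(4-7)])
  qed
  then show ?thesis using H reducible_finite[OF H(3)] by simp
qed (use s in simp)

lemma reducible_card_le:
  assumes s: "s \<ge> 3" and red: "reducible H"
  shows "card H + 4 \<le> 4 * s"
proof (cases "H = {}")
  case False
  then obtain H' A B v a b where H: "H = insert {a, b} H'" "reducible H'" "cut A B v" "uncrossed A B H'"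
    using reducible_cases red by metis
  then show ?thesis
    using second_cut[OF s H(2-4)] reducible_finite[OF H(2)] by (simp add: card_insert_if)
qed (use s in simp)

section \<open>Construction of an extremal edge set\<close>

text \<open>The sides are \<open>A\<close> and \<open>V - insert v A\<close>. An edge at the centre
  \<open>v\<close> cannot cross them, so only such edges may leave \<open>A\<close>.\<close>

lemma add_edge:
  assumes red: "reducible H" and A: "A \<subseteq> V" "card A = s" "v \<in> V" "v \<notin> A"
    and ab: "a \<in> A" "b \<in> V" "b \<notin> A" "b \<noteq> v"
    and sep: "\<And>e. e \<in> H \<Longrightarrow> v \<in> e \<or> e \<subseteq> A \<or> e \<inter> A = {}"
  shows "reducible (insert {a, b} H)"
proof (rule reducible.step[OF red _ _ ab(1)])
  have "finite A" using A finite_V finite_subset by blast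
  then have "card (V - insert v A) = s"
    using A card_V by (subst card_Diff_subset) auto
  then show "cut A (V - insert v A) v" unfolding cut_def using A by auto
  show "uncrossed A (V - insert v A) H" unfolding uncrossed_def using sep A(4) by blast
  show "b \<in> V - insert v A" using ab by blast
qed

text \<open>Supplies a side that takes in the finished set \<open>S\<close> with a new vertex
  \<open>x\<close> and stays clear of the blob \<open>Y\<close> being built. There is room because
  |V - Y| \<ge> s + 1.\<close>

lemma extend_avoiding:
  assumes "S \<subseteq> V" "card S < s" "Y \<subseteq> V" "card Y \<le> s" "S \<inter> Y = {}" "x \<in> V" "x \<notin> Y"
  shows "\<exists>A. insert x S \<subseteq> A \<and> A \<subseteq> V - Y \<and> card A = s"
proof -
  have fS: "finite S" "finite Y" using assms finite_V finite_subset by blast+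
  have "card (insert x S) \<le> s" using fS assms by (simp add: card_insert_if)
  moreover have "s \<le> card (V - Y)" using assms fS card_V by (simp add: card_Diff_subset)
  moreover have "insert x S \<subseteq> V - Y" using assms by blast
  ultimately show ?thesis using finite_V exists_subset_between[of "insert x S" s "V - Y"] by auto
qed

text \<open>Each \<open>x\<close> is joined to both \<open>u\<close> and \<open>w\<close>; while one of these two edges is deleted, the cut leaves
  out the endpoint of the other.\<close>

lemma add_blob:
  assumes red: "reducible H" and S: "S \<subseteq> V" "card S < s" and H: "\<And>e. e \<in> H \<Longrightarrow> e \<subseteq> S"
    and X: "finite X" "X \<subseteq> V - S" "card X + 2 \<le> s" and uw: "u \<in> V - S" "w \<in> V - S" "u \<noteq> w"
    "u \<notin> X" "w \<notin> X"
  shows "\<exists>H'. reducible H' \<and> (\<forall>e\<in>H'. e \<subseteq> S \<or> e \<subseteq> insert u (insert w X))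
    \<and> card H' = card H + 2 * card X + 1"
  using X uw(4,5)
proof (induction rule: finite_induct)
  case empty
  obtain A where A: "insert u S \<subseteq> A" "A \<subseteq> V - {w}" "card A = s"
    using extend_avoiding[OF S, of "{w}" u] uw S by auto
  have "finite A" "w \<notin> A" using A finite_V finite_subset[of A V] by auto
  then have "card (V - insert w A) = s"
    using A uw card_V by (subst card_Diff_subset) auto
  then have "card (V - insert w A) \<noteq> 0" using S by linarith
  then have "V - insert w A \<noteq> {}" by fastforce
  \<comment> \<open>Any further vertex off \<open>A\<close> serves as centre, since every edge of
    \<open>H\<close> lies in \<open>S\<close> and thus in \<open>A\<close>.\<close>
  then obtain v where v: "v \<in> V" "v \<notin> A" "v \<noteq> w" by blast
  have "reducible (insert {u, w} H)"
    by (rule add_edge[OF red _ A(3) v(1,2)]) (use A uw v H in auto)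
  moreover have "{u, w} \<notin> H" using H uw by blast
  ultimately show ?case using H reducible_finite[OF red] by (intro exI[of _ "insert {u, w} H"]) auto
next
  case (insert x X)
  let ?J = "insert u (insert w X)"
  obtain H' where H': "reducible H'" "\<And>e. e \<in> H' \<Longrightarrow> e \<subseteq> S \<or> e \<subseteq> ?J"
    "card H' = card H + 2 * card X + 1"
    using insert.IH insert.prems insert.hyps by auto
  have x: "x \<in> V" "x \<notin> S" "x \<notin> ?J" using insert by auto
  have J: "?J \<subseteq> V" "S \<inter> ?J = {}" "card ?J \<le> s" using insert uw by (auto simp: card_insert_if)
  \<comment> \<open>One side for both new edges: it contains the old blob and \<open>x\<close> but
    nothing of \<open>?J\<close>, so no edge of \<open>H'\<close> leaves it.\<close>
  obtain A where A: "insert x S \<subseteq> A" "A \<subseteq> V - ?J" "card A = s"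
    using extend_avoiding[OF S J(1,3,2) x(1,3)] by blast
  have AV: "A \<subseteq> V" "x \<in> A" "u \<notin> A" "w \<notin> A" "u \<in> V" "w \<in> V" using A uw by auto
  have sep: "e \<subseteq> A \<or> e \<inter> A = {}" if "e \<in> H'" for e using H'(2)[OF that] A by auto
  have 1: "reducible (insert {x, w} H')"
    by (rule add_edge[OF H'(1) AV(1) A(3) AV(5,3,2,6,4)]) (use uw(3) sep in auto)
  have 2: "reducible (insert {x, u} (insert {x, w} H'))"
    by (rule add_edge[OF 1 AV(1) A(3) AV(6,4,2,5,3)]) (use uw(3) sep in auto)
  have "{x, w} \<notin> H'" "{x, u} \<notin> insert {x, w} H'" using H'(2) x uw by (auto simp: doubleton_eq_iff)
  then have "card (insert {x, u} (insert {x, w} H')) = card H + 2 * card (insert x X) + 1"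
    using reducible_finite[OF H'(1)] H'(3) insert.hyps by simp
  then show ?case using 2 H'(2)
    by (intro exI[of _ "insert {x, u} (insert {x, w} H')"]) auto
qed

text \<open>The graph consists of two edge-maximal sparse graphs on disjoint sets \<open>K\<close> and \<open>L\<close> of sizes
  \<open>s - 1\<close> and \<open>s\<close>, with \<open>2 * s - 5\<close> and \<open>2 * s - 3\<close> edges, a pendant edge at each of them, and two
  edges from \<open>K\<close> to \<open>L\<close>.\<close>

lemma reducible_extremal:
  assumes s: "s \<ge> 3"
  shows "\<exists>H. reducible H \<and> card H + 4 = 4 * s"
proof -
  have "s - 1 \<le> card V" using card_V by linarith
  then obtain K where K: "K \<subseteq> V" "card K = s - 1" using ex_subset_of_card by blast
  have fK: "finite K" using K finite_V finite_subset by blast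
  have "card (V - K) = s + 2" using K fK card_V s by (simp add: card_Diff_subset)
  then obtain L where L: "L \<subseteq> V - K" "card L = s"
    using ex_subset_of_card[of s "V - K"] le_add1[of s 2] by metis
  have fL: "finite L" using L finite_V finite_subset by blast
  have "card (V - K - L) = 2" using L fL \<open>card (V - K) = s + 2\<close> by (simp add: card_Diff_subset)
  then obtain p q where pq: "V - K - L = {p, q}" "p \<noteq> q" by (meson card_2_iff)
  have split: "\<exists>x y Z. J = insert x (insert y Z) \<and> x \<noteq> y \<and> x \<notin> Z \<and> y \<notin> Z \<and> finite Z \<and> card Z + 2 = card J"
    if J: "finite J" "card J \<ge> 2" for J :: "'a set"
  proof -
    obtain T where T: "T \<subseteq> J" "card T = 2" using ex_subset_of_card[OF J(2)] by blast
    then obtain x y where xy: "T = {x, y}" "x \<noteq> y" by (meson card_2_iff)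
    then have "card (J - {x, y}) + 2 = card J" using T J by (simp add: card_Diff_subset)
    then show ?thesis using T xy J by (intro exI[of _ x] exI[of _ y] exI[of _ "J - {x, y}"]) auto
  qed
  have c: "card K \<ge> 2" "card L \<ge> 2" using K L s by linarith+
  obtain k k' K' where K': "K = insert k (insert k' K')" "k \<noteq> k'" "k \<notin> K'" "k' \<notin> K'"
    "finite K'" "card K' + 2 = card K" using split[OF fK c(1)] by metis
  obtain l l' L' where L': "L = insert l (insert l' L')" "l \<noteq> l'" "l \<notin> L'" "l' \<notin> L'"
    "finite L'" "card L' + 2 = card L" using split[OF fL c(2)] by metis
  obtain H1 where H1: "reducible H1" "\<And>e. e \<in> H1 \<Longrightarrow> e \<subseteq> K" "card H1 = 2 * card K' + 1"
    using add_blob[OF reducible.empty, of "{}" K' k k'] K K' s by auto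
  obtain H2 where H2: "reducible H2" "\<And>e. e \<in> H2 \<Longrightarrow> e \<subseteq> K \<or> e \<subseteq> L"
    "card H2 = card H1 + 2 * card L' + 1"
    using add_blob[OF H1(1) K(1) _ H1(2), of L' l l'] K L L' s by auto
  have pqV: "p \<in> V" "q \<in> V" "p \<notin> K" "q \<notin> K" "p \<notin> L" "q \<notin> L" using pq by auto
  have kl: "k \<in> K" "l \<in> L" "l' \<in> L" "k \<notin> L" "l \<notin> K" "l' \<notin> K" "l \<noteq> l'" using K' L' L by auto
  have klV: "k \<in> V" "l \<in> V" "l' \<in> V" using kl K L by auto
  have neq: "k \<noteq> p" "k \<noteq> q" "l \<noteq> p" "l \<noteq> q" "l' \<noteq> p" "l' \<noteq> q" "k \<noteq> l" "k \<noteq> l'" using kl pqV by auto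
  have KL: "K \<inter> L = {}" "L \<subseteq> V" using L by auto
  let ?H3 = "insert {k, p} H2" let ?H4 = "insert {l, q} ?H3"
  let ?H5 = "insert {k, l} ?H4" let ?H6 = "insert {k, l'} ?H5"
  \<comment> \<open>A side needs s vertices: \<open>L\<close> is one already, and \<open>K\<close>
    becomes one by adding \<open>p\<close> or \<open>q\<close>.\<close>
  have cp: "card (insert p K) = s" "card (insert q K) = s" using fK K pqV s by auto
  have sepK: "e \<subseteq> insert x K \<or> e \<inter> insert x K = {}" if "e \<in> H2" "x \<notin> L" for e x
    using H2(2)[OF that(1)] KL(1) that(2) by auto
  have sepL: "e \<subseteq> L \<or> e \<inter> L = {}" if "e \<in> H2" for e
    using H2(2)[OF that] KL(1) by auto
  have 3: "reducible (insert {k, p} H2)"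
    by (rule add_edge[OF H2(1) _ cp(2), where v = l])
      (use K(1) pqV kl klV neq pq(2) sepK in auto)
  have 4: "reducible ?H4"
    by (rule add_edge[OF 3 KL(2) L(2), where v = p])
      (use pqV kl klV neq pq(2) sepL in auto)
  \<comment> \<open>The centre \<open>q\<close> neutralises the pendant edge at \<open>l\<close>,
    which would otherwise obstruct later cuts at \<open>l\<close>; the other pendant edge lies
    inside the side \<open>insert p K\<close>.\<close>
  have 5: "reducible ?H5"
    by (rule add_edge[OF 4 _ cp(1), where v = q])
      (use K(1) pqV kl klV neq pq(2) sepK in auto)
  have 6: "reducible ?H6"
    \<comment> \<open>The centre is now \<open>l\<close>, an end of both earlier edges that could
      cross, \<open>{l, q}\<close> and \<open>{k, l}\<close>.\<close>
    by (rule add_edge[OF 5 _ cp(1), where v = l])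
      (use K(1) pqV kl klV neq pq(2) sepK in auto)
  have "{k, p} \<notin> H2" "{l, q} \<notin> ?H3" "{k, l} \<notin> ?H4" "{k, l'} \<notin> ?H5"
    using H2(2) kl pqV neq pq(2) by (auto simp: doubleton_eq_iff)
  then have "card ?H6 = card H2 + 4" using reducible_finite[OF H2(1)] by simp
  then show ?thesis using 6 H1(3) H2(3) K'(6) L'(6) K L s by (intro exI[of _ ?H6]) auto
qed

section \<open>Translation between edge deletions and weak saturation\<close>

lemma uncrossed_iff: "uncrossed A B H \<longleftrightarrow> biclique A B \<inter> H = {}"
  unfolding uncrossed_def biclique_def by blast

lemma copy_cut:
  assumes "copy_in K (complete_bipartite s s) G" "verts G = V"
  shows "\<exists>A B v. cut A B v \<and> edges K = biclique A B \<and> biclique A B \<subseteq> edges G"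
proof -
  obtain A B where AB: "A \<inter> B = {}" "A \<union> B \<subseteq> V" "card A = s" "card B = s"
    "edges K = biclique A B" "biclique A B \<subseteq> edges G"
    using copy_complete_bipartite_biclique[OF assms(1)] assms(2) by metis
  have "finite A" "finite B" using AB(2) finite_V finite_subset by blast+
  then have "card (A \<union> B) = 2 * s" using AB by (simp add: card_Un_disjoint)
  then have "card (V - (A \<union> B)) = 1"
    using AB(2) card_V finite_V finite_subset[OF AB(2)] by (simp add: card_Diff_subset)
  then obtain v where v: "V - (A \<union> B) = {v}" by (meson card_1_singletonE)
  have "cut A B v" unfolding cut_def using AB v by auto
  then show ?thesis using AB by blast
qed

lemma cut_copy:
  assumes "cut A B v" "biclique A B \<subseteq> edges G" "verts G = V"
  shows "\<exists>K. copy_in K (complete_bipartite s s) G \<and> edges K = biclique A B"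
  using biclique_copy_complete_bipartite[of A B G] cutD[OF assms(1)] assms(2,3)
  by (metis Un_least graph.sel(2))

lemma biclique_complete: "cut A B v \<Longrightarrow> biclique A B \<subseteq> edges (complete_graph V)"
  using cutD(1,7,8)[of A B v] unfolding biclique_def complete_graph_def by fastforce

text \<open>The suffix \<open>drop i es\<close> holds the edges still missing before
  \<open>es ! i\<close> is added, and the new copy avoids all later ones. Since
  \<open>reducible\<close> grows from the empty set, the induction runs down from the full length of
  the list.\<close>

lemma reducible_complement:
  assumes sat: "weakly_saturated (complete_bipartite s s) G" and G: "verts G = V"
  shows "reducible (edges (complete_graph V) - edges G)"
proof -
  obtain es where es: "distinct es" "set es = edges (complete_graph V) - edges G"
    and add: "\<And>i. i < length es \<Longrightarrow> \<exists>K. copy_in K (complete_bipartite s s)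
      (add_edges G (set (take (Suc i) es))) \<and> es ! i \<in> edges K"
    using sat unfolding weakly_saturated_def G by metis
  have "reducible (set (drop i es))" if "i \<le> length es" for i
    using that
  proof (induction rule: inc_induct)
    case base
    then show ?case by (simp add: reducible.empty)
  next
    case (step i)
    obtain K where K: "copy_in K (complete_bipartite s s) (add_edges G (set (take (Suc i) es)))"
      "es ! i \<in> edges K" using add[OF step.hyps(2)] by blast
    obtain A B v where AB: "cut A B v" "edges K = biclique A B"
      "biclique A B \<subseteq> edges G \<union> set (take (Suc i) es)"
      using copy_cut[OF K(1)] G by (auto simp: add_edges_def)
    have "set (take (Suc i) es) \<inter> set (drop (Suc i) es) = {}"
      using es(1) set_take_disj_set_drop_if_distinct by blast
    moreover have "set (drop (Suc i) es) \<inter> edges G = {}" using es(2) set_drop_subset by fastforce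
    ultimately have "uncrossed A B (set (drop (Suc i) es))" using AB(3) unfolding uncrossed_iff by blast
    moreover obtain a b where "es ! i = {a, b}" "a \<in> A" "b \<in> B"
      using K(2) unfolding AB(2) biclique_def by blast
    moreover have "set (drop i es) = insert (es ! i) (set (drop (Suc i) es))"
      using step.hyps(2) by (metis Cons_nth_drop_Suc list.simps(15))
    ultimately show ?case using reducible.step[OF step.IH AB(1)] by metis
  qed
  from this[of 0] show ?thesis using es(2) by simp
qed

lemma reducible_complete:
  assumes "reducible H"
  shows "H \<subseteq> edges (complete_graph V)"
proof
  fix e
  assume "e \<in> H"
  then obtain x y where "e = {x, y}" "x \<noteq> y" "x \<in> V" "y \<in> V" using reducible_edge[OF assms] by blast
  then show "e \<in> edges (complete_graph V)" unfolding complete_graph_def by auto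
qed

text \<open>Prepares the converse direction: the outermost rule of a derivation supplies the head of
  the list, so list order is the order in which edges are added to the graph.\<close>

lemma reducible_list:
  assumes "reducible H"
  shows "\<exists>es. distinct es \<and> set es = H \<and> (\<forall>i<length es. \<exists>A B v. cut A B v
    \<and> es ! i \<in> biclique A B \<and> uncrossed A B (set (drop (Suc i) es)))"
  using assms
proof (induction rule: reducible.induct)
  case empty
  then show ?case by simp
next
  case (step H A B v a b)
  obtain es where "distinct es \<and> set es = H \<and> (\<forall>i<length es. \<exists>A B v. cut A B v
    \<and> es ! i \<in> biclique A B \<and> uncrossed A B (set (drop (Suc i) es)))" using step.IH ..
  then have es: "distinct es" "set es = H" "i < length es \<Longrightarrow> \<exists>A B v. cut A B v
    \<and> es ! i \<in> biclique A B \<and> uncrossed A B (set (drop (Suc i) es))" for i by auto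
  let ?es = "{a, b} # es"
  have "{a, b} \<in> biclique A B" using step.hyps(4,5) unfolding biclique_def by blast
  moreover have "{a, b} \<notin> H" using step.hyps(3-5) unfolding uncrossed_def by blast
  moreover have "\<exists>A B v. cut A B v \<and> ?es ! i \<in> biclique A B \<and> uncrossed A B (set (drop (Suc i) ?es))"
    if "i < length ?es" for i
  proof (cases i)
    case 0
    then show ?thesis using \<open>{a, b} \<in> biclique A B\<close> step.hyps(2,3) es(2) by auto
  next
    case (Suc j)
    then show ?thesis using es(3)[of j] that by simp
  qed
  ultimately show ?case using es(1,2) by (intro exI[of _ ?es]) auto
qed

lemma weakly_saturated_extremal:
  assumes s: "s \<ge> 3" and red: "reducible H" and card: "card H + 4 = 4 * s"
  shows "weakly_saturated (complete_bipartite s s) (Graph V (edges (complete_graph V) - H))"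
proof -
  let ?E = "edges (complete_graph V)" let ?G = "Graph V (?E - H)"
  have HE: "H \<subseteq> ?E" using reducible_complete[OF red] .
  have "verts (complete_graph V) = V" by (simp add: complete_graph_def)
  have "\<not> copy_in K (complete_bipartite s s) ?G" for K
  proof
    assume "copy_in K (complete_bipartite s s) ?G"
    then obtain A B v where "cut A B v" "biclique A B \<subseteq> ?E - H" using copy_cut by force
    then have "card H + 5 \<le> 4 * s"
      using second_cut[OF s red, of A B v] unfolding uncrossed_iff by blast
    then show False using card by simp
  qed
  moreover obtain es where "distinct es \<and> set es = H \<and> (\<forall>i<length es. \<exists>A B v. cut A B v
    \<and> es ! i \<in> biclique A B \<and> uncrossed A B (set (drop (Suc i) es)))"
    using reducible_list[OF red] ..
  then have es: "distinct es" "set es = H" "i < length es \<Longrightarrow> \<exists>A B v. cut A B v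
    \<and> es ! i \<in> biclique A B \<and> uncrossed A B (set (drop (Suc i) es))" for i by auto
  moreover have "\<exists>K. copy_in K (complete_bipartite s s) (add_edges ?G (set (take (Suc i) es)))
      \<and> es ! i \<in> edges K" if i: "i < length es" for i
  proof -
    obtain A B v where AB: "cut A B v" "es ! i \<in> biclique A B" "uncrossed A B (set (drop (Suc i) es))"
      using es(3)[OF i] by blast
    \<comment> \<open>The edges missing from the current graph are those of the suffix, and none of
      them crosses the cut; so the whole biclique is present.\<close>
    have "H = set (take (Suc i) es) \<union> set (drop (Suc i) es)"
      using es(2) by (metis append_take_drop_id set_append)
    then have "biclique A B \<subseteq> (?E - H) \<union> set (take (Suc i) es)"
      using biclique_complete[OF AB(1)] AB(3) unfolding uncrossed_iff by blast
    then show ?thesis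
      using cut_copy[OF AB(1), of "add_edges ?G (set (take (Suc i) es))"] AB(2)
      by (auto simp: add_edges_def)
  qed
  moreover have "set es = edges (complete_graph (verts ?G)) - edges ?G"
    using HE es(2) by (simp add: double_diff)
  moreover have "simple_graph ?G" unfolding simple_graph_def using finite_V by simp
  ultimately show ?thesis unfolding weakly_saturated_def by blast
qed

end

theorem theorem1:
  fixes s :: nat
  assumes "s > 2"
  shows "int (wsat (2 * s + 1) (complete_bipartite s s)) =
           int ((2 * s + 1) choose 2) - (4 * int s - 4)"
proof -
  let ?V = "{..<2 * s + 1}" let ?E = "edges (complete_graph ?V)"
  interpret balanced_cuts ?V s by unfold_locales auto
  have s: "s \<ge> 3" using assms by simp
  have E: "card ?E = (2 * s + 1) choose 2" using card_edges_complete_graph[of ?V] by simp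
  have finE: "finite ?E"
    by (rule finite_subset[of _ "Pow ?V"]) (auto simp: complete_graph_def)
  have compl: "card (edges G) + card (?E - edges G) = card ?E"
    if "edges G \<subseteq> ?E" for G :: "nat graph"
    using that finE by (metis card_Diff_subset card_mono finite_subset le_add_diff_inverse)
  have lower: "card ?E + 4 \<le> card (edges G) + 4 * s"
    if "verts G = ?V" "weakly_saturated (complete_bipartite s s) G" for G
  proof -
    have "edges G \<subseteq> ?E" using that unfolding weakly_saturated_def simple_graph_def by simp
    then show ?thesis
      using compl[of G] reducible_card_le[OF s reducible_complement[OF that(2,1)]] by linarith
  qed
  obtain H where H: "reducible H" "card H + 4 = 4 * s" using reducible_extremal[OF s] by blast
  have HE: "H \<subseteq> ?E" using reducible_complete[OF H(1)] .
  let ?G = "Graph ?V (?E - H)"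
  have sat: "weakly_saturated (complete_bipartite s s) ?G"
    using weakly_saturated_extremal[OF s H] .
  have cG: "card (edges ?G) + card H = card ?E"
    using compl[of ?G] HE by (simp add: double_diff)
  have "wsat (2 * s + 1) (complete_bipartite s s) = card (edges ?G)"
    unfolding wsat_def
  proof (rule Least_equality)
    show "\<exists>G. verts G = ?V \<and> weakly_saturated (complete_bipartite s s) G \<and> card (edges G) = card (edges ?G)"
      using sat by (intro exI[of _ ?G]) simp
    show "card (edges ?G) \<le> m"
      if "\<exists>G. verts G = ?V \<and> weakly_saturated (complete_bipartite s s) G \<and> card (edges G) = m" for m
      using that lower cG H(2) by fastforce
  qed
  then show ?thesis using cG H(2) E by linarith
qed

end
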